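(* For every integer $r \ge 2$ and every integer $n \ge 4r^2$, there is an $n$-vertex $r$-graph $\mathcal{H}$ such that every set of $r+1$ vertices of $\mathcal{H}$ spans exactly $0$ or $2$ edges and $$|\mathcal{H}| \ge \frac{1}{32r^3}\binom{n}{r}.$$
   Context: An $r$-graph is an $r$-uniform hypergraph: a finite vertex set together with a set of edges, each an $r$-element subset of the vertex set; $|\mathcal{H}|$ is its number of edges. A vertex set $S$ spans the edges that are contained in $S$. *)

theory Defs
  imports Complex_Main
begin

text \<open>An \<open>r\<close>-graph is given by its vertex set \<open>V\<close> and its edge set \<open>E\<close>.
  Since \<open>V\<close> is finite, so are all edges and the edge set itself; hence \<open>card\<close> is
  the true cardinality in each case.\<close>

definition r_graph :: "nat \<Rightarrow> 'a set \<Rightarrow> 'a set set \<Rightarrow> bool" where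
  "r_graph r V E \<longleftrightarrow> finite V \<and> (\<forall>e\<in>E. e \<subseteq> V \<and> card e = r)"

definition spanned_edges :: "'a set set \<Rightarrow> 'a set \<Rightarrow> 'a set set" where
  "spanned_edges E S = {e \<in> E. e \<subseteq> S}"

end

theory Submission
  imports Defs "HOL-Algebra.Algebraic_Closure_Type" "HOL-Library.Z2" "HOL-Library.Product_Plus"
begin

text \<open>
  Suppose \<open>G\<close> is a family of \<open>(r - 1)\<close>-sets, no two of which lie in a common \<open>(r + 1)\<close>-set. Then the
  \<open>r\<close>-sets that contain a member of \<open>G\<close> have the \<open>{0, 2}\<close> property, because exactly two \<open>r\<close>-sets lie
  between \<open>g \<in> G\<close> and an \<open>(r + 1)\<close>-set that contains it. If the vertices are elements of a Sidon set,
  the sets with a prescribed sum form such a family. The property survives blow-ups (a vertex \<open>v\<close>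
  being replaced by a class of vertices \<open>u\<close> with \<open>f u = v\<close>, and edges being transversals). As a Sidon
  set we take the curve \<open>(x, x\<^sup>3)\<close> over the field with \<open>q\<close> elements, where \<open>q\<close> is the power of two
  with \<open>2r\<^sup>2 \<le> q < 4r\<^sup>2\<close>. For a random map \<open>f\<close> from the vertices to the curve and a random
  prescribed sum, an \<open>r\<close>-set is mapped injectively with probability at least \<open>(1 - r/q)\<^sup>r \<ge> 1/2\<close>, and
  then \<open>r\<close> of the \<open>q\<^sup>2\<close> sums make it an edge; so some choice yields density at least
  \<open>r / (2q\<^sup>2) \<ge> 1 / (32r\<^sup>3)\<close>.
\<close>

section \<open>Finite fields and Sidon sums in characteristic two\<close>

lemma frobenius_char_two:
  fixes x y :: "'a :: comm_ring_1"
  assumes "(2 :: 'a) = 0"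
  shows "(x + y) ^ (2 ^ m) = x ^ (2 ^ m) + y ^ (2 ^ m)"
proof (induction m)
  case (Suc m)
  have sq: "(a + b) ^ 2 = a ^ 2 + b ^ 2" for a b :: 'a
    using assms by (simp add: power2_sum)
  have "(x + y) ^ (2 ^ Suc m) = ((x + y) ^ (2 ^ m)) ^ 2"
    by (simp add: power_mult mult.commute flip: power_mult)
  also have "\<dots> = (x ^ (2 ^ m)) ^ 2 + (y ^ (2 ^ m)) ^ 2"
    by (simp only: Suc.IH sq)
  also have "\<dots> = x ^ (2 ^ Suc m) + y ^ (2 ^ Suc m)"
    by (simp add: mult.commute flip: power_mult)
  finally show ?case .
qed simp

text \<open>With \<open>q = 2 ^ m\<close>, the polynomial \<open>x ^ q - x\<close> splits and has
  derivative \<open>- 1\<close>, so its \<open>q\<close> roots are distinct. They model the field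
  with \<open>q\<close> elements.\<close>

lemma card_fixed_points_frobenius:
  assumes "(2 :: 'a :: alg_closed_field) = 0" and "m \<ge> 1"
  shows "card {x :: 'a. x ^ (2 ^ m) = x} = 2 ^ m"
proof -
  define q :: nat where "q = 2 ^ m"
  have q: "q \<ge> 2"
    using assms(2) power_increasing[of 1 m "2::nat"] by (simp add: q_def)
  have q0: "of_nat q = (0 :: 'a)"
    using assms by (simp add: q_def)
  define p :: "'a poly" where "p = monom 1 q - [:0, 1:]"
  have poly_p: "poly p x = x ^ q - x" for x
    by (simp add: p_def poly_monom)
  have coeff_q: "coeff p q = 1"
    using q by (simp add: p_def coeff_pCons split: nat.splits)
  have p0: "p \<noteq> 0"
    using coeff_q by auto
  have deg: "degree p = q"
  proof (rule antisym)
    show "degree p \<le> q"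
      unfolding p_def using q by (intro degree_diff_le) (auto simp: degree_monom_eq)
    show "q \<le> degree p"
      using coeff_q by (intro le_degree) auto
  qed
  have pd: "pderiv p = - 1"
    using q0 by (simp add: p_def pderiv_diff pderiv_monom pderiv_pCons one_pCons)
  have order_le: "order a p \<le> 1" for a
  proof (rule ccontr)
    assume "\<not> order a p \<le> 1"
    hence "[:-a, 1:] ^ 2 dvd p"
      by (simp add: order_divides)
    then obtain s where s: "p = [:-a, 1:] ^ 2 * s"
      by (elim dvdE)
    have "poly (pderiv p) a = 0"
      unfolding s power2_eq_square pderiv_mult poly_add poly_mult by simp
    thus False
      by (simp add: pd)
  qed
  obtain A where A: "size A = degree p" "p = smult (lead_coeff p) (\<Prod>x\<in>#A. [:-x, 1:])"
    using alg_closed_imp_factorization[OF p0] by blast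
  have "proots p = A"
  proof -
    have "proots p = proots (\<Prod>x\<in>#A. [:-x, 1:])"
      using p0 by (subst A(2)) simp
    also have "\<dots> = (\<Sum>x\<in>#A. proots [:-x, 1:])"
      using proots_prod_mset[of "image_mset (\<lambda>x. [:-x, 1:]) A"]
      by (simp add: image_mset.compositionality o_def image_iff)
    finally show ?thesis
      by simp
  qed
  hence "q = size (proots p)"
    using A deg by simp
  also have "\<dots> = (\<Sum>x\<in>{x. poly p x = 0}. order x p)"
    using p0 by (simp add: size_multiset_overloaded_eq)
  also have "\<dots> = (\<Sum>x\<in>{x. poly p x = 0}. 1)"
  proof (rule sum.cong)
    fix x assume "x \<in> {x. poly p x = 0}"
    hence "order x p > 0"
      using p0 by (simp add: order_gt_0_iff)
    thus "order x p = 1"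
      using order_le[of x] by simp
  qed simp
  finally show ?thesis
    by (simp add: poly_p q_def)
qed

text \<open>Since \<open>a ^ 3 + b ^ 3 = s * (s ^ 2 - 3 * (a * b))\<close> with
  \<open>s = a + b\<close> nonzero, the two sums determine \<open>a * b\<close>, hence the quadratic
  with roots \<open>a\<close> and \<open>b\<close>.\<close>

lemma sidon_char_two:
  fixes a b c d :: "'a :: field"
  assumes two: "(2 :: 'a) = 0" and "a \<noteq> b"
    and s: "a + b = c + d" and t: "a ^ 3 + b ^ 3 = c ^ 3 + d ^ 3"
  shows "{a, b} = {c, d}"
proof -
  have uminus: "- x = x" for x :: 'a
    using two by (metis add_eq_0_iff mult_2 mult_zero_left)
  have cube: "x ^ 3 + y ^ 3 = (x + y) * ((x + y) ^ 2 - 3 * (x * y))" for x y :: 'a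
    by (simp add: power2_eq_square power3_eq_cube algebra_simps)
  have three: "(3 :: 'a) = 1"
    using two by (metis add_0 numeral_plus_one semiring_norm(5))
  have "a + b \<noteq> 0"
    using \<open>a \<noteq> b\<close> uminus by (metis add_eq_0_iff)
  hence "(c + d) ^ 2 - 3 * (a * b) = (c + d) ^ 2 - 3 * (c * d)"
    using t unfolding cube s by simp
  hence "a * b = c * d"
    by (simp add: three)
  moreover have "(a - c) * (a - d) = a * a - a * (c + d) + c * d"
    by (simp add: algebra_simps)
  ultimately have "(a - c) * (a - d) = 0"
    unfolding s[symmetric] by (simp add: algebra_simps)
  thus ?thesis
    using s by auto
qed

text \<open>The condition \<open>a \<noteq> b\<close> is essential: in characteristic two, \<open>a + a = c + c\<close> for all \<open>a\<close> and \<open>c\<close>.\<close>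

definition sidon_set :: "'a :: ab_group_add set \<Rightarrow> bool" where
  "sidon_set A \<longleftrightarrow>
     (\<forall>a\<in>A. \<forall>b\<in>A. \<forall>c\<in>A. \<forall>d\<in>A. a \<noteq> b \<and> a + b = c + d \<longrightarrow> {a, b} = {c, d})"

section \<open>Blow-ups over a Sidon set\<close>

text \<open>The classes of the blow-up are the fibres of \<open>f\<close>, and
  \<open>inj_on f e\<close> makes \<open>e\<close> a transversal of them.\<close>

definition almost_sum_edges :: "'v set \<Rightarrow> nat \<Rightarrow> ('v \<Rightarrow> 'a :: ab_group_add) \<Rightarrow> 'a \<Rightarrow> 'v set set" where
  "almost_sum_edges V r f t =
     {e. e \<subseteq> V \<and> card e = r \<and> inj_on f e \<and> (\<exists>v\<in>e. sum f (e - {v}) = t)}"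

text \<open>For an edge \<open>S - {p}\<close> some \<open>p'\<close> must bring
  \<open>f p + f p'\<close> to a value fixed by \<open>S\<close> and \<open>t\<close>. If
  \<open>f\<close> is injective on \<open>S\<close>, the Sidon property leaves one pair, and both
  its members can be missed. Otherwise the missed vertex is one of two colliding vertices, which are
  interchangeable.\<close>

lemma card_spanned_almost_sum_edges:
  assumes A: "sidon_set A" and fS: "f ` S \<subseteq> A" and S: "S \<subseteq> V" "card S = r + 1"
  shows "card (spanned_edges (almost_sum_edges V r f t) S) \<in> {0, 2}"
proof -
  have fin: "finite S"
    using S(2) card.infinite by fastforce
  \<comment> \<open>An edge inside \<open>S\<close> is determined by the vertex \<open>p\<close> that it misses.\<close>
  define P where
    "P = {p \<in> S. inj_on f (S - {p}) \<and> (\<exists>p'\<in>S - {p}. f p + f p' = sum f S - t)}"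
  have sum_eq: "sum f (S - {p} - {p'}) = t \<longleftrightarrow> f p + f p' = sum f S - t"
    if "p \<in> S" "p' \<in> S - {p}" for p p'
    using that fin by (auto simp: sum_diff1 algebra_simps)
  have "spanned_edges (almost_sum_edges V r f t) S = (\<lambda>p. S - {p}) ` P"
  proof (intro equalityI subsetI)
    fix e assume "e \<in> spanned_edges (almost_sum_edges V r f t) S"
    then obtain v where e: "e \<subseteq> S" "card e = r" "inj_on f e" "v \<in> e" "sum f (e - {v}) = t"
      by (auto simp: spanned_edges_def almost_sum_edges_def)
    have "card (S - e) = 1"
      using e S fin by (simp add: card_Diff_subset finite_subset)
    then obtain p where p: "S - e = {p}"
      by (auto simp: card_1_singleton_iff)
    hence "e = S - {p}" "p \<in> S"
      using e(1) by auto
    with e sum_eq[of p v] have "p \<in> P"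
      by (auto simp: P_def)
    with \<open>e = S - {p}\<close> show "e \<in> (\<lambda>p. S - {p}) ` P"
      by blast
  next
    fix e assume "e \<in> (\<lambda>p. S - {p}) ` P"
    then obtain p p' where p: "e = S - {p}" "p \<in> S" "inj_on f e" "p' \<in> S - {p}"
      "f p + f p' = sum f S - t"
      by (auto simp: P_def)
    with sum_eq[of p p'] S fin show "e \<in> spanned_edges (almost_sum_edges V r f t) S"
      by (auto simp: spanned_edges_def almost_sum_edges_def)
  qed
  moreover have "inj_on (\<lambda>p. S - {p}) P"
  proof (rule inj_onI)
    fix p p' assume "p \<in> P" "p' \<in> P" "S - {p} = S - {p'}"
    moreover from this have "p \<in> S" "p' \<in> S"
      by (simp_all add: P_def)
    ultimately show "p = p'"
      by blast
  qed
  ultimately have card_eq: "card (spanned_edges (almost_sum_edges V r f t) S) = card P"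
    by (simp add: card_image)
  \<comment> \<open>One companion for each member of \<open>P\<close> rules out every size except 0
    and 2.\<close>
  have "\<exists>p''. p'' \<noteq> p \<and> P = {p, p''}" if pP: "p \<in> P" for p
  proof -
    obtain p' where p: "p \<in> S" "inj_on f (S - {p})" "p' \<in> S" "p' \<noteq> p"
      "f p + f p' = sum f S - t"
      using pP by (auto simp: P_def)
    show ?thesis
    proof (cases "inj_on f S")
      case True
      have "y \<in> {p, p'}" if y: "y \<in> P" for y
      proof -
        obtain y' where y': "y \<in> S" "y' \<in> S" "f y + f y' = sum f S - t"
          using y by (auto simp: P_def)
        have "f p \<noteq> f p'"
          using True p by (auto dest: inj_onD)
        moreover have "f p + f p' = f y + f y'"
          using p y' by simp
        ultimately have "{f p, f p'} = {f y, f y'}"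
          using A fS p(1,3) y'(1,2) unfolding sidon_set_def by blast
        hence "f y = f p \<or> f y = f p'"
          by (auto simp: doubleton_eq_iff)
        thus ?thesis
          using True p y' by (auto dest: inj_onD)
      qed
      moreover have "p' \<in> P"
        using p True by (auto simp: P_def add.commute intro: inj_on_subset)
      ultimately have "P = {p, p'}"
        using pP by blast
      thus ?thesis
        using p by blast
    next
      case False
      then obtain a b where "a \<in> S" "b \<in> S" "a \<noteq> b" "f a = f b"
        by (auto simp: inj_on_def)
      \<comment> \<open>As \<open>f\<close> is injective off \<open>p\<close>, every collision in
        \<open>S\<close> involves \<open>p\<close>. Missing a vertex other than \<open>p\<close> and
        \<open>b\<close> would keep this one.\<close>
      then obtain b where b: "b \<in> S" "b \<noteq> p" "f b = f p"
        using p(2) by (cases "a = p"; cases "b = p") (auto simp: inj_on_def)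
      have "y \<in> {p, b}" if "y \<in> P" for y
      proof (rule ccontr)
        assume "y \<notin> {p, b}"
        moreover have "inj_on f (S - {y})"
          using that by (simp add: P_def)
        ultimately show False
          using b p(1) by (auto simp: inj_on_def)
      qed
      moreover have "b \<in> P"
      proof -
        have only_p: "x = p" if "x \<in> S - {b}" "f x = f p" for x
          using inj_onD[OF p(2), of x b] b that by auto
        have "inj_on f (S - {b})"
        proof (rule inj_onI)
          fix x y assume xy: "x \<in> S - {b}" "y \<in> S - {b}" "f x = f y"
          show "x = y"
            using xy only_p[of x] only_p[of y] inj_onD[OF p(2), of x y]
            by (cases "x = p \<or> y = p") auto
        qed
        \<comment> \<open>The partner \<open>p'\<close> of \<open>p\<close> also serves
          \<open>b\<close>, as \<open>f b = f p\<close>; if \<open>p'\<close> is \<open>b\<close>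
          itself, \<open>p\<close> takes its place.\<close>
        moreover have "\<exists>y\<in>S - {b}. f b + f y = sum f S - t"
          using p b by (cases "p' = b") auto
        ultimately show ?thesis
          using b by (simp add: P_def)
      qed
      ultimately have "P = {p, b}"
        using pP by blast
      thus ?thesis
        using b by blast
    qed
  qed
  hence "card P \<in> {0, 2}"
    by (cases "P = {}") (auto simp: card_2_iff)
  thus ?thesis
    by (simp add: card_eq)
qed

section \<open>Double counting and averaging\<close>

lemma card_almost_sums:
  fixes f :: "'v \<Rightarrow> 'a :: ab_group_add"
  assumes "finite e" "inj_on f e"
  shows "card ((\<lambda>v. sum f (e - {v})) ` e) = card e"
proof (rule card_image, rule inj_onI)
  fix v w assume "v \<in> e" "w \<in> e" "sum f (e - {v}) = sum f (e - {w})"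
  with assms show "v = w"
    by (simp add: sum_diff1 inj_on_eq_iff)
qed

text \<open>The sum is counted from the side of the \<open>r\<close>-sets: each map injective on
  \<open>e\<close> makes \<open>e\<close> an edge for exactly \<open>r\<close> targets
  \<open>t\<close>, all of which lie in \<open>B\<close> by \<open>sums\<close>.\<close>

lemma sum_card_almost_sum_edges:
  fixes A B :: "'a :: ab_group_add set"
  assumes fin: "finite V" "finite A" "finite B" and r: "r \<le> card V"
    and sums: "\<And>(f :: 'v \<Rightarrow> 'a) e. e \<subseteq> V \<Longrightarrow> f \<in> V \<rightarrow>\<^sub>E A \<Longrightarrow> sum f e \<in> B"
  shows "(\<Sum>(f, t)\<in>(V \<rightarrow>\<^sub>E A) \<times> B. card (almost_sum_edges V r f t)) =
    (card V choose r) * (r * (card A ^ (card V - r) * prod ((-) (card A)) {0..<r}))"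
proof -
  define R where "R = {e. e \<subseteq> V \<and> card e = r}"
  define inc where
    "inc = (\<lambda>(f :: 'v \<Rightarrow> 'a, t) e. inj_on f e \<and> (\<exists>v\<in>e. sum f (e - {v}) = t))"
  have card_pairs: "card {ft \<in> (V \<rightarrow>\<^sub>E A) \<times> B. inc ft e} =
      r * (card A ^ (card V - r) * prod ((-) (card A)) {0..<r})" if e: "e \<in> R" for e
  proof -
    have fine: "finite e" and eV: "e \<subseteq> V" and er: "card e = r"
      using e fin(1) by (auto simp: R_def intro: finite_subset)
    have "{ft \<in> (V \<rightarrow>\<^sub>E A) \<times> B. inc ft e} =
        (SIGMA f:{f \<in> V \<rightarrow>\<^sub>E A. inj_on f e}. (\<lambda>v. sum f (e - {v})) ` e)"
      using eV by (auto simp: inc_def intro!: sums)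
    also have "card \<dots> = (\<Sum>f\<in>{f \<in> V \<rightarrow>\<^sub>E A. inj_on f e}. card ((\<lambda>v. sum f (e - {v})) ` e))"
    proof (rule card_SigmaI)
      have "finite (V \<rightarrow>\<^sub>E A)"
        using fin by (simp add: finite_PiE)
      thus "finite {f \<in> V \<rightarrow>\<^sub>E A. inj_on f e}"
        by simp
    qed (use fine in simp)
    also have "\<dots> = (\<Sum>f\<in>{f \<in> V \<rightarrow>\<^sub>E A. inj_on f e}. r)"
      using fine er by (intro sum.cong) (auto simp: card_almost_sums)
    also have "\<dots> = r * card {f \<in> V \<rightarrow>\<^sub>E A. inj_on f e}"
      by simp
    finally show ?thesis
      using card_inj_on_subset_funcset[OF fin(1,2) eV] er by simp
  qed
  have "(\<Sum>(f, t)\<in>(V \<rightarrow>\<^sub>E A) \<times> B. card (almost_sum_edges V r f t)) =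
      (\<Sum>ft\<in>(V \<rightarrow>\<^sub>E A) \<times> B. card {e \<in> R. inc ft e})"
    by (intro sum.cong) (auto simp: almost_sum_edges_def R_def inc_def)
  also have "\<dots> = (\<Sum>e\<in>R. r * (card A ^ (card V - r) * prod ((-) (card A)) {0..<r}))"
  proof (rule sum_multicount_gen[where R = inc])
    show "finite ((V \<rightarrow>\<^sub>E A) \<times> B)"
      using fin by (simp add: finite_PiE)
    show "finite R"
      using fin(1) by (simp add: R_def)
  qed (use card_pairs in blast)
  also have "\<dots> = card R * (r * (card A ^ (card V - r) * prod ((-) (card A)) {0..<r}))"
    by simp
  also have "card R = card V choose r"
    unfolding R_def using fin(1) by (rule n_subsets)
  finally show ?thesis .
qed

text \<open>Every factor is at least \<open>q - r\<close>, and Bernoulli's inequality gives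
  \<open>(1 - r / q) ^ r \<ge> 1 - r ^ 2 / q \<ge> 1 / 2\<close>.\<close>

lemma falling_factorial_ge_half_power:
  assumes "2 * r ^ 2 \<le> q" and "r \<ge> 1"
  shows "real q ^ r \<le> 2 * real (prod ((-) q) {0..<r})"
proof -
  have "r \<le> r ^ 2"
    using assms(2) by (simp add: power2_eq_square)
  hence rq: "r \<le> q" and q: "q > 0"
    using assms by linarith+
  have "1 / 2 \<le> 1 + real r * (- real r / real q)"
  proof -
    have "2 * real r ^ 2 \<le> real q"
      using assms(1) by (metis of_nat_le_iff of_nat_mult of_nat_numeral of_nat_power)
    thus ?thesis
      using q by (simp add: field_simps power2_eq_square)
  qed
  also have "\<dots> \<le> (1 + - real r / real q) ^ r"
    using rq q by (intro Bernoulli_inequality) simp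
  finally have "real q ^ r / 2 \<le> real q ^ r * (1 + - real r / real q) ^ r"
    using mult_left_mono[of "1 / 2" _ "real q ^ r"] by simp
  also have "\<dots> = real ((q - r) ^ r)"
    using q rq by (simp add: field_simps flip: power_mult_distrib)
  also have "(q - r) ^ r \<le> prod ((-) q) {0..<r}"
  proof -
    have "(\<Prod>i\<in>{0..<r}. q - r) \<le> prod ((-) q) {0..<r}"
      by (intro prod_mono) auto
    thus ?thesis
      by simp
  qed
  finally show ?thesis
    by simp
qed

lemma exists_ge_average:
  fixes g :: "'a \<Rightarrow> nat"
  assumes "card I > 0"
  shows "\<exists>i\<in>I. sum g I \<le> card I * g i"
proof (rule ccontr)
  assume "\<not> ?thesis"
  hence "(\<Sum>i\<in>I. card I * g i) < of_nat (card I) * sum g I"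
    using assms by (intro sum_bounded_above_strict) auto
  thus False
    by (simp add: sum_distrib_left)
qed

section \<open>The cubic curve and the choice of parameters\<close>

text \<open>\<open>B\<close> is the pool of target sums, and averaging over it costs a factor
  \<open>card B\<close>. The plane over the finite field contains the curve and is closed under
  addition, so it holds sums of any length.\<close>

lemma sidon_set_char_two:
  assumes "(2 :: 'a :: alg_closed_field) = 0" and "m \<ge> 1"
  obtains A B :: "('a :: alg_closed_field \<times> 'a) set"
  where "sidon_set A" "card A = 2 ^ m" "card B = (2 ^ m) ^ 2"
    "\<And>e (f :: 'v \<Rightarrow> 'a \<times> 'a). f ` e \<subseteq> A \<Longrightarrow> sum f e \<in> B"
proof
  define K where "K = {x :: 'a. x ^ (2 ^ m) = x}"
  define A where "A = (\<lambda>x. (x, x ^ 3)) ` K"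
  have cardK: "card K = 2 ^ m"
    unfolding K_def by (rule card_fixed_points_frobenius[OF assms])
  show "sidon_set A"
    unfolding sidon_set_def
  proof (intro ballI impI)
    fix a b c d assume mem: "a \<in> A" "b \<in> A" "c \<in> A" "d \<in> A"
      and eq: "a \<noteq> b \<and> a + b = c + d"
    obtain x y z w where xyzw: "a = (x, x ^ 3)" "b = (y, y ^ 3)" "c = (z, z ^ 3)" "d = (w, w ^ 3)"
      using mem unfolding A_def by blast
    have "x \<noteq> y" "x + y = z + w" "x ^ 3 + y ^ 3 = z ^ 3 + w ^ 3"
      using eq unfolding xyzw by (simp_all add: plus_prod_def)
    hence "{x, y} = {z, w}"
      by (rule sidon_char_two[OF assms(1)])
    thus "{a, b} = {c, d}"
      unfolding xyzw by (auto simp only: doubleton_eq_iff)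
  qed
  show "card A = 2 ^ m"
    unfolding A_def cardK[symmetric] by (intro card_image) (auto simp: inj_on_def)
  show "card (K \<times> K) = (2 ^ m) ^ 2"
    unfolding card_cartesian_product cardK power2_eq_square ..
  have K0: "0 \<in> K"
    by (simp add: K_def)
  have K_add: "x + y \<in> K" if "x \<in> K" "y \<in> K" for x y
    using that frobenius_char_two[OF assms(1), of x y m] by (simp add: K_def)
  have K_cube: "x ^ 3 \<in> K" if "x \<in> K" for x
    using that unfolding K_def mem_Collect_eq by (metis mult.commute power_mult)
  have AK: "A \<subseteq> K \<times> K"
    using K_cube by (auto simp: A_def)
  show "sum f e \<in> K \<times> K" if "f ` e \<subseteq> A" for e and f :: "'v \<Rightarrow> 'a \<times> 'a"
    using that
  \<comment> \<open>For infinite \<open>e\<close> the sum is 0 by convention.\<close>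
  proof (induction e rule: infinite_finite_induct)
    case (insert v e)
    hence "f v \<in> K \<times> K" "sum f e \<in> K \<times> K"
      using AK by auto
    thus ?case
      using insert.hyps K_add by (auto simp: mem_Times_iff)
  qed (use K0 in \<open>auto simp: zero_prod_def\<close>)
qed

theorem theorem2:
  fixes r n :: nat
  assumes "r \<ge> 2" and "n \<ge> 4 * r ^ 2"
  shows "\<exists>(V :: nat set) (E :: nat set set).
           r_graph r V E \<and> card V = n \<and>
           (\<forall>S. S \<subseteq> V \<and> card S = r + 1 \<longrightarrow> card (spanned_edges E S) \<in> {0, 2}) \<and>
           real (card E) \<ge> 1 / (32 * real r ^ 3) * real (n choose r)"
proof -
  have "2 * r ^ 2 \<ge> 2" and rn: "r \<le> n"
    using assms power_increasing[of 1 2 r] by (auto simp: Suc_le_eq)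
  then obtain m where m: "2 ^ m < 2 * r ^ 2" "2 * r ^ 2 \<le> 2 ^ (m + 1)"
    using ex_power_ivl2[of 2 "2 * r ^ 2"] by auto
  \<comment> \<open>The least power of two that is at least \<open>2 * r ^ 2\<close>: the lower
    bound feeds Bernoulli's inequality, the upper bound gives the final constant.\<close>
  define q :: nat where "q = 2 ^ (m + 1)"
  have q: "2 * r ^ 2 \<le> q" "q \<le> 4 * r ^ 2" "q > 0"
    using m by (auto simp: q_def)
  have two: "(2 :: bit alg_closure) = 0"
    using to_ac_numeral[of "num.Bit0 num.One", where 'a = bit] by simp
  obtain A B :: "(bit alg_closure \<times> bit alg_closure) set"
    where A: "sidon_set A" "card A = q" and B: "card B = q ^ 2"
      and sums: "\<And>e (f :: nat \<Rightarrow> bit alg_closure \<times> bit alg_closure). f ` e \<subseteq> A \<Longrightarrow> sum f e \<in> B"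
    using sidon_set_char_two[OF two, of "m + 1"] unfolding q_def by auto
  have fin: "finite A" "finite B"
    using A(2) B q(3) by (auto intro: card_ge_0_finite)
  define V :: "nat set" where "V = {..<n}"
  have V: "finite V" "card V = n"
    by (auto simp: V_def)
  define I where "I = (V \<rightarrow>\<^sub>E A) \<times> B"
  define g where "g = (\<lambda>(f, t :: bit alg_closure \<times> bit alg_closure). card (almost_sum_edges V r f t))"
  have cardI: "card I = q ^ n * q ^ 2"
    using V A(2) B by (simp add: I_def card_cartesian_product card_funcsetE)
  then obtain f t where f: "f \<in> V \<rightarrow>\<^sub>E A" and avg: "sum g I \<le> card I * g (f, t)"
    using exists_ge_average[of I g] q(3) by (auto simp: I_def)
  define E where "E = almost_sum_edges V r f t"
  define c where "c = real (n choose r) * real r"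
  have "sum g I = (n choose r) * (r * (q ^ (n - r) * prod ((-) q) {0..<r}))"
    using sum_card_almost_sum_edges[OF V(1) fin, of r] rn sums
    unfolding I_def g_def V(2) A(2) by (metis PiE_mem image_subsetI subsetD)
  hence total: "real (sum g I) = c * real q ^ (n - r) * real (prod ((-) q) {0..<r})"
    by (simp only: c_def of_nat_mult of_nat_power mult.assoc)
  \<comment> \<open>Set against the \<open>q ^ n * q ^ 2\<close> pairs in \<open>I\<close>, the
    total has average at least \<open>c / (2 * q ^ 2)\<close>.\<close>
  have "c * real q ^ n = c * real q ^ (n - r) * real q ^ r"
    using rn by (simp flip: power_add)
  also have "\<dots> \<le> c * real q ^ (n - r) * (2 * real (prod ((-) q) {0..<r}))"
    using falling_factorial_ge_half_power[OF q(1)] assms(1)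
    by (intro mult_left_mono) (auto simp: c_def)
  also have "\<dots> = 2 * real (sum g I)"
    by (simp only: total mult_ac)
  also have "\<dots> \<le> 2 * real (card I * g (f, t))"
    using avg by (intro mult_left_mono) (simp_all only: of_nat_le_iff zero_le_numeral)
  also have "\<dots> = real q ^ n * (2 * real q ^ 2 * real (card E))"
    by (simp add: cardI g_def E_def)
  finally have "c \<le> 2 * real q ^ 2 * real (card E)"
    using q(3) by (simp add: mult.commute)
  also have "\<dots> \<le> 2 * (4 * real r ^ 2) ^ 2 * real (card E)"
  proof -
    have "real q \<le> 4 * real r ^ 2"
      using q(2) by (metis of_nat_le_iff of_nat_mult of_nat_numeral of_nat_power)
    thus ?thesis
      by (intro mult_right_mono mult_left_mono power_mono) auto
  qed
  \<comment> \<open>One of the four factors \<open>r\<close> is split off to cancel the one in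
    \<open>c\<close>.\<close>
  also have "\<dots> = (32 * real r ^ 3 * real (card E)) * real r"
    by (simp add: power2_eq_square power3_eq_cube)
  finally have "real (n choose r) \<le> 32 * real r ^ 3 * real (card E)"
    using assms(1) by (simp add: c_def)
  hence large: "real (card E) \<ge> 1 / (32 * real r ^ 3) * real (n choose r)"
    using assms(1) by (simp add: field_simps)
  have "r_graph r V E"
    using V(1) by (auto simp: r_graph_def E_def almost_sum_edges_def)
  moreover have "card (spanned_edges E S) \<in> {0, 2}" if "S \<subseteq> V" "card S = r + 1" for S
    unfolding E_def using f that
    by (intro card_spanned_almost_sum_edges[OF A(1)]) auto
  ultimately show ?thesis
    using V(2) large by blast
qed

end
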